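(* Let $P$ be a finite set of primes and let $b\ge 2$ be an integer relatively prime to every prime in $P$. Then there is a constant $c>0$ depending only on $P$ such that for all sufficiently large $m\in\mathbb{N}_P$, all $a\in\mathbb{Z}$ with $\gcd(a,m)=1$, and all $N\in\mathbb{N}$ satisfying \[ \exp\!\left(\frac{\log m}{\log_2\log m-3\log_2\log\log m}\right)\le N, \] we have \[ \frac1N\left|\sum_{n=1}^N e\!\left(\frac{a}{m}b^n\right)\right|\le \exp\!\left(-c(\log\log m)^{3/2}\right). \]
   Context: $e(z)=e^{2\pi i z}$. For a finite set of primes $P$, $\mathbb{N}_P$ denotes the set of positive integers all of whose prime factors lie in $P$ (with $1\in\mathbb{N}_P$). $\log$ is the natural logarithm and $\log_2$ is the base-2 logarithm. *)

theory Defs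
  imports Complex_Main "HOL-Computational_Algebra.Primes"
begin

definition e :: "complex \<Rightarrow> complex" where
  "e z = exp (2 * of_real pi * \<i> * z)"

definition smooth_over :: "nat set \<Rightarrow> nat set" ("\<nat>\<^bsub>_\<^esub>") where
  "\<nat>\<^bsub>P\<^esub> = {m. m > 0 \<and> (\<forall>p. prime p \<and> p dvd m \<longrightarrow> p \<in> P)}"

end

theory Submission
  imports Defs "HOL-Number_Theory.Residues" "HOL-Analysis.Analysis" "HOL-Real_Asymp.Real_Asymp"
begin

text \<open>
  Differencing a sum over \<open>e(a b\<^sup>n / m)\<close> with a shift \<open>s\<close> yields a sum of the same kind, with numerator
  \<open>a (b\<^sup>s - 1)\<close>, so the modulus drops to \<open>m / gcd(m, b\<^sup>s - 1)\<close>. Choose \<open>\<tau>\<close> with \<open>p\<^sup>2\<close> dividing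
  \<open>b\<^sup>\<tau> - 1\<close> for every \<open>p\<close> in \<open>P\<close>. Lifting the exponent shows that, for a divisor \<open>q\<close> of \<open>m\<close> and
  \<open>s = \<tau> q h\<close>, this gcd is \<open>q\<close> up to a constant and up to the \<open>P\<close>-part of \<open>h\<close>, which is rarely large.
  One van der Corput step therefore replaces the saving \<open>\<theta>\<close> by \<open>\<theta>\<^sup>2\<close> and divides the modulus by almost
  \<open>\<theta>\<^sup>2 N\<close>. Since all prime factors of \<open>m\<close> are bounded, \<open>q\<close> can be adapted to the current modulus. Once the
  modulus is below \<open>\<theta> N / \<tau>\<close> the vanishing of sums over full periods gives the bound. With
  \<open>\<theta> = exp (- 2 c (log log m)\<^bsup>3/2\<^esup>)\<close> and \<open>k\<close> steps, where
  \<open>k\<close> is about \<open>log\<^sub>2 log m - (5/2) log\<^sub>2 log log m\<close>, the total loss \<open>\<theta>\<^bsup>-O(2^k)\<^esup>\<close> is a small power of \<open>N\<close>.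
\<close>

subsection \<open>Lifting the exponent\<close>

lemma power_eq_1_plus_geometric_sum:
  fixes x :: nat
  assumes "x \<ge> 1"
  shows "x ^ n = 1 + (x - 1) * (\<Sum>i<n. x ^ i)"
proof (induction n)
  case (Suc n)
  have "x ^ Suc n = x ^ n + (x - 1) * x ^ n"
    using assms by (cases x) auto
  then show ?case using Suc by (simp add: algebra_simps)
qed simp

lemma geometric_sum_cong:
  fixes x :: nat
  assumes "[x = 1] (mod q)"
  shows "[(\<Sum>i<n. x ^ i) = n] (mod q)"
proof -
  have "[(\<Sum>i<n. x ^ i) = (\<Sum>i<n. 1)] (mod q)"
    by (intro cong_sum) (use cong_pow[OF assms] in auto)
  then show ?thesis by simp
qed

lemma dvd_diff_1_iff_cong:
  fixes x :: nat
  assumes "x \<ge> 1"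
  shows "q dvd x - 1 \<longleftrightarrow> [x = 1] (mod q)"
  using assms by (metis cong_altdef_nat cong_sym_eq)

text \<open>Factors \<open>p\<close> of \<open>n\<close> are stripped off one at a time. If
  \<open>p\<close> does not divide \<open>n\<close>, the geometric sum is \<open>n\<close> modulo
  \<open>p\<close> and adds nothing. Otherwise the sum of \<open>p\<close> powers is
  \<open>p\<close> modulo \<open>p\<^sup>2\<close>, so it carries exactly one factor
  \<open>p\<close>. Working modulo \<open>p\<^sup>2\<close> makes this valid for
  \<open>p = 2\<close> as well.\<close>

lemma multiplicity_power_diff_1:
  fixes x p :: nat
  assumes p: "prime p" and x: "x \<ge> 2" and dvd: "p\<^sup>2 dvd x - 1" and "n > 0"
  shows "multiplicity p (x ^ n - 1) = multiplicity p (x - 1) + multiplicity p n"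
  using \<open>n > 0\<close>
proof (induction n rule: less_induct)
  case (less n)
  have cong: "[x ^ k = 1] (mod p\<^sup>2)" for k
    using cong_pow[of x 1 "p\<^sup>2" k] dvd x dvd_diff_1_iff_cong[of x "p\<^sup>2"] by simp
  have pos: "x ^ k - 1 \<noteq> 0" if "k > 0" for k
    using that x one_less_power[of x k] by linarith
  show ?case
  proof (cases "p dvd n")
    case False
    define s where "s = (\<Sum>i<n. x ^ i)"
    have eq: "x ^ n - 1 = (x - 1) * s"
      using power_eq_1_plus_geometric_sum[of x n] x by (simp add: s_def)
    have "[s = n] (mod p)"
      unfolding s_def using cong[of 1] 
      by (intro geometric_sum_cong) (auto intro: cong_dvd_modulus_nat simp: power2_eq_square)
    then have "\<not> p dvd s"
      using False cong_dvd_iff by blast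
    moreover have "s \<noteq> 0" using eq pos[of n] less.prems by force
    ultimately show ?thesis
      using False eq p x
      by (simp add: prime_elem_multiplicity_mult_distrib not_dvd_imp_multiplicity_0)
  next
    case True
    then obtain n' where n: "n = p * n'" by auto
    have n': "n' < n" "n' > 0"
      using n less.prems p prime_gt_1_nat[of p] by auto
    define s where "s = (\<Sum>i<p. (x ^ n') ^ i)"
    have eq: "x ^ n - 1 = (x ^ n' - 1) * s"
      using power_eq_1_plus_geometric_sum[of "x ^ n'" p] x
      by (simp add: s_def n mult.commute flip: power_mult)
    have s: "[s = p] (mod p\<^sup>2)"
      unfolding s_def by (intro geometric_sum_cong cong)
    have "s \<noteq> 0" using eq pos[of n] less.prems by force
    have "p dvd s"
      using s by (metis cong_dvd_iff cong_dvd_modulus_nat dvd_refl dvd_triv_left power2_eq_square)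
    moreover have "\<not> p\<^sup>2 dvd s"
    proof
      assume "p\<^sup>2 dvd s"
      then have "p\<^sup>2 dvd p" using s cong_dvd_iff by blast
      then have "p\<^sup>2 \<le> p" using p prime_gt_0_nat by (intro dvd_imp_le) auto
      then show False using p prime_gt_1_nat[of p] by (simp add: power2_eq_square)
    qed
    ultimately have ms: "multiplicity p s = 1"
      by (intro multiplicity_eqI) (auto simp: numeral_2_eq_2)
    have "multiplicity p n = 1 + multiplicity p n'"
      using n n' p by (simp add: prime_elem_multiplicity_mult_distrib prime_gt_0_nat)
    then show ?thesis
      using less.IH[OF n'] eq ms p pos[OF n'(2)] \<open>s \<noteq> 0\<close>
      by (simp add: prime_elem_multiplicity_mult_distrib)
  qed
qed

subsection \<open>Additive characters\<close>

definition unit_char :: "nat \<Rightarrow> int \<Rightarrow> complex" where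
  "unit_char m j = e (of_int j / of_nat m)"

lemma unit_char_add: "unit_char m (i + j) = unit_char m i * unit_char m j"
  by (simp add: unit_char_def e_def add_divide_distrib exp_add distrib_left)

lemma unit_char_eq_cis: "unit_char m j = cis (2 * pi * (of_int j / of_nat m))"
  by (simp add: unit_char_def e_def cis_conv_exp mult_ac)

lemma norm_unit_char [simp]: "cmod (unit_char m j) = 1"
  by (simp add: unit_char_eq_cis)

lemma cnj_unit_char: "cnj (unit_char m j) = unit_char m (- j)"
  by (simp add: unit_char_eq_cis cis_cnj)

lemma unit_char_of_nat_mult: "unit_char m (of_nat n * j) = unit_char m j ^ n"
proof (induction n)
  case (Suc n)
  have "of_nat (Suc n) * j = j + of_nat n * j" by (simp add: algebra_simps)
  then show ?case using Suc by (simp only: unit_char_add power_Suc)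
qed (simp add: unit_char_eq_cis)

lemma unit_char_eq_1_iff:
  assumes "m > 0"
  shows "unit_char m j = 1 \<longleftrightarrow> int m dvd j"
proof -
  have *: "2 * pi * (of_int j / of_nat m) = of_int (2 * k) * pi \<longleftrightarrow> j = int m * k" for k :: int
  proof -
    have "2 * pi * (of_int j / of_nat m) = of_int (2 * k) * pi \<longleftrightarrow>
        (of_int j :: real) = of_int (int m * k)"
      using assms by (auto simp: field_simps)
    then show ?thesis by (simp only: of_int_eq_iff)
  qed
  have "unit_char m j = 1 \<longleftrightarrow> (\<exists>k::int. 2 * pi * (of_int j / of_nat m) = of_int (2 * k) * pi)"
    unfolding unit_char_eq_cis cis_conv_exp exp_eq_1 by simp
  also have "\<dots> \<longleftrightarrow> int m dvd j"
    unfolding * by (auto simp: dvd_def)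
  finally show ?thesis .
qed

lemma unit_char_cong:
  assumes "m > 0" "int m dvd i - j"
  shows "unit_char m i = unit_char m j"
proof -
  have "unit_char m i = unit_char m (j + (i - j))" by simp
  also have "\<dots> = unit_char m j * unit_char m (i - j)"
    by (rule unit_char_add)
  also have "unit_char m (i - j) = 1"
    using assms by (simp add: unit_char_eq_1_iff)
  finally show ?thesis by simp
qed

lemma unit_char_cancel:
  assumes "d > 0"
  shows "unit_char (d * m) (int d * j) = unit_char m j"
  using assms by (simp add: unit_char_def)

subsection \<open>The van der Corput inequality\<close>

lemma sum_power2_le_card_mult:
  fixes f :: "'a \<Rightarrow> complex"
  shows "(cmod (\<Sum>i\<in>I. f i))\<^sup>2 \<le> real (card I) * (\<Sum>i\<in>I. (cmod (f i))\<^sup>2)"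
proof -
  have "(cmod (\<Sum>i\<in>I. f i))\<^sup>2 \<le> (\<Sum>i\<in>I. 1 * cmod (f i))\<^sup>2"
    by (intro power_mono) (auto intro: norm_sum)
  also have "\<dots> \<le> (\<Sum>i\<in>I. 1\<^sup>2) * (\<Sum>i\<in>I. (cmod (f i))\<^sup>2)"
    by (rule Cauchy_Schwarz_ineq_sum)
  finally show ?thesis by simp
qed

text \<open>Each distance \<open>d > 0\<close> from \<open>h\<close> is attained at most once on
  either side. The conditional is the absolute difference in natural numbers.\<close>

lemma sum_nat_dist_le:
  fixes C :: "nat \<Rightarrow> real"
  assumes "h < H" and "\<And>d. C d \<ge> 0"
  shows "(\<Sum>h'<H. C (if h \<le> h' then h' - h else h - h')) \<le> C 0 + 2 * (\<Sum>d\<in>{1..<H}. C d)"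
proof -
  have split: "{..<H} = {..<h} \<union> {h} \<union> {h<..<H}" using assms(1) by auto
  have "(\<Sum>h'<H. C (if h \<le> h' then h' - h else h - h')) =
        (\<Sum>h'<h. C (h - h')) + C 0 + (\<Sum>h'\<in>{h<..<H}. C (h' - h))"
    unfolding split by (subst sum.union_disjoint; (simp; fail)?)+ auto
  also have "(\<Sum>h'<h. C (h - h')) = (\<Sum>d\<in>{1..h}. C d)"
    by (rule sum.reindex_bij_witness[of _ "\<lambda>d. h - d" "\<lambda>d. h - d"]) auto
  also have "\<dots> \<le> (\<Sum>d\<in>{1..<H}. C d)"
    using assms by (intro sum_mono2) auto
  also have "(\<Sum>h'\<in>{h<..<H}. C (h' - h)) = (\<Sum>d\<in>{1..<H - h}. C d)"
    by (rule sum.reindex_bij_witness[of _ "\<lambda>d. d + h" "\<lambda>d. d - h"]) auto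
  also have "\<dots> \<le> (\<Sum>d\<in>{1..<H}. C d)"
    using assms by (intro sum_mono2) auto
  finally show ?thesis by simp
qed

text \<open>The sum is averaged over \<open>H\<close> translates by multiples of \<open>s\<close>;
  Cauchy-Schwarz over \<open>n\<close> and expanding the square leave correlations at distances
  \<open>(h' - h) * s\<close>. A free majorant \<open>C\<close> lets some distances be estimated
  trivially.\<close>

lemma van_der_corput:
  fixes f :: "nat \<Rightarrow> complex"
  assumes H: "H > 0" and len: "real M + real (H * s) \<le> L"
    and C: "\<And>d. d < H \<Longrightarrow> cmod (\<Sum>i=1..M - d * s. f (i + d * s) * cnj (f i)) \<le> C d"
    and nn: "\<And>d. C d \<ge> 0"
  shows "(cmod (\<Sum>n=1..M. f n))\<^sup>2 \<le> L / H * (C 0 + 2 * (\<Sum>d\<in>{1..<H}. C d))"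
proof -
  define F where "F = (\<lambda>n. if n \<in> {1..M} then f n else 0)"
  \<comment> \<open>Truncated subtraction in \<open>F (n - h * s)\<close> is harmless because \<open>F 0 = 0\<close>.\<close>
  define I where "I = {1..M + H * s}"
  define S where "S = (\<Sum>n=1..M. f n)"
  have shift: "(\<Sum>n\<in>I. F (n - h * s)) = S" if "h < H" for h
  proof -
    have "(\<Sum>n\<in>I. F (n - h * s)) = (\<Sum>n\<in>{1 + h * s..M + h * s}. F (n - h * s))"
      using that mult_right_mono[of h H s]
      by (intro sum.mono_neutral_right) (auto simp: I_def F_def)
    also have "\<dots> = (\<Sum>n\<in>{1..M}. F n)"
      by (rule sum.reindex_bij_witness[of _ "\<lambda>d. d + h * s" "\<lambda>d. d - h * s"]) auto
    finally show ?thesis by (simp add: S_def F_def)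
  qed
  have corr: "(\<Sum>n\<in>I. F (n - h * s) * cnj (F (n - h' * s))) =
      (\<Sum>i=1..M - (h' - h) * s. f (i + (h' - h) * s) * cnj (f i))"
    if "h < H" "h' < H" "h \<le> h'" for h h'
  proof -
    have hs: "h' * s = h * s + (h' - h) * s"
      using that by (simp flip: add_mult_distrib)
    have "(\<Sum>n\<in>I. F (n - h * s) * cnj (F (n - h' * s))) =
        (\<Sum>n\<in>{1 + h' * s..M + h * s}. F (n - h * s) * cnj (F (n - h' * s)))"
      using mult_right_mono[of h H s] that
      by (intro sum.mono_neutral_right) (auto simp: I_def F_def)
    also have "\<dots> = (\<Sum>i=1..M - (h' - h) * s. f (i + (h' - h) * s) * cnj (f i))"
      by (rule sum.reindex_bij_witness[of _ "\<lambda>d. d + h' * s" "\<lambda>d. d - h' * s"])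
        (auto simp: F_def hs)
    finally show ?thesis .
  qed
  have bound: "cmod (\<Sum>n\<in>I. F (n - h * s) * cnj (F (n - h' * s)))
      \<le> C (if h \<le> h' then h' - h else h - h')" if "h < H" "h' < H" for h h'
  proof (cases "h \<le> h'")
    case True
    then show ?thesis using corr[of h h'] C[of "h' - h"] that by simp
  next
    case False
    \<comment> \<open>Swapping \<open>h\<close> and \<open>h'\<close> conjugates the correlation, so
      its modulus is unchanged.\<close>
    have "(\<Sum>n\<in>I. F (n - h' * s) * cnj (F (n - h * s))) =
        cnj (\<Sum>n\<in>I. F (n - h * s) * cnj (F (n - h' * s)))"
      by (simp add: mult.commute)
    then have "cmod (\<Sum>n\<in>I. F (n - h * s) * cnj (F (n - h' * s))) =
        cmod (\<Sum>n\<in>I. F (n - h' * s) * cnj (F (n - h * s)))"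
      by (simp only: complex_mod_cnj)
    then show ?thesis using False corr[of h' h] C[of "h - h'"] that by simp
  qed
  have "(cmod (of_nat H * S))\<^sup>2 = (cmod (\<Sum>h<H. \<Sum>n\<in>I. F (n - h * s)))\<^sup>2"
    using shift by simp
  also have "\<dots> = (cmod (\<Sum>n\<in>I. \<Sum>h<H. F (n - h * s)))\<^sup>2"
    by (subst sum.swap) simp
  also have "\<dots> \<le> real (card I) * (\<Sum>n\<in>I. (cmod (\<Sum>h<H. F (n - h * s)))\<^sup>2)"
    by (rule sum_power2_le_card_mult)
  also have "(\<Sum>n\<in>I. (cmod (\<Sum>h<H. F (n - h * s)))\<^sup>2) \<le>
      (\<Sum>h<H. \<Sum>h'<H. C (if h \<le> h' then h' - h else h - h'))"
  proof -
    \<comment> \<open>Squared moduli become products with conjugates, so that they can be multiplied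
      out and the sum over \<open>n\<close> moved innermost.\<close>
    have "complex_of_real (\<Sum>n\<in>I. (cmod (\<Sum>h<H. F (n - h * s)))\<^sup>2) =
        (\<Sum>n\<in>I. (\<Sum>h<H. F (n - h * s)) * cnj (\<Sum>h<H. F (n - h * s)))"
      by (simp only: of_real_sum complex_norm_square)
    also have "\<dots> = (\<Sum>n\<in>I. \<Sum>h<H. \<Sum>h'<H. F (n - h * s) * cnj (F (n - h' * s)))"
      by (simp add: sum_product)
    also have "\<dots> = (\<Sum>h<H. \<Sum>n\<in>I. \<Sum>h'<H. F (n - h * s) * cnj (F (n - h' * s)))"
      by (rule sum.swap)
    also have "\<dots> = (\<Sum>h<H. \<Sum>h'<H. \<Sum>n\<in>I. F (n - h * s) * cnj (F (n - h' * s)))"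
      by (rule sum.cong[OF refl sum.swap])
    finally have eq: "complex_of_real (\<Sum>n\<in>I. (cmod (\<Sum>h<H. F (n - h * s)))\<^sup>2) = \<dots>" .
    have "(\<Sum>n\<in>I. (cmod (\<Sum>h<H. F (n - h * s)))\<^sup>2) =
        cmod (complex_of_real (\<Sum>n\<in>I. (cmod (\<Sum>h<H. F (n - h * s)))\<^sup>2))"
      by (simp only: norm_of_real abs_of_nonneg sum_nonneg zero_le_power2)
    also have "\<dots> \<le> (\<Sum>h<H. \<Sum>h'<H. C (if h \<le> h' then h' - h else h - h'))"
      unfolding eq by (intro sum_norm_le) (use bound in auto)
    finally show ?thesis .
  qed
  also have "\<dots> \<le> (\<Sum>h<H. C 0 + 2 * (\<Sum>d\<in>{1..<H}. C d))"
    using nn by (intro sum_mono sum_nat_dist_le) auto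
  also have "real (card I) * \<dots> \<le> L * \<dots>"
    using len nn by (intro mult_right_mono) (auto simp: I_def intro!: mult_nonneg_nonneg add_nonneg_nonneg sum_nonneg)
  finally have "(real H)\<^sup>2 * (cmod S)\<^sup>2 \<le> L * (real H * (C 0 + 2 * (\<Sum>d\<in>{1..<H}. C d)))"
    by (simp add: norm_mult power_mult_distrib mult_left_mono)
  then have "real H * (real H * (cmod S)\<^sup>2) \<le> real H * (L * (C 0 + 2 * (\<Sum>d\<in>{1..<H}. C d)))"
    by (simp add: power2_eq_square mult_ac)
  then have "real H * (cmod S)\<^sup>2 \<le> L * (C 0 + 2 * (\<Sum>d\<in>{1..<H}. C d))"
    using H by (simp only: mult_le_cancel_left_pos of_nat_0_less_iff)
  then show ?thesis
    using H by (simp only: S_def times_divide_eq_left le_divide_eq of_nat_0_less_iff if_True mult.commute)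
qed

subsection \<open>Periodic sums and smooth numbers\<close>

lemma sum_periodic_shift:
  fixes f :: "nat \<Rightarrow> 'a::ab_group_add"
  assumes "\<And>n. f (n + T) = f n"
  shows "(\<Sum>n<T. f (n + s)) = (\<Sum>n<T. f n)"
proof (induction s)
  case (Suc s)
  have "(\<Sum>n<T. f (n + Suc s)) + f s = (\<Sum>n<Suc T. f (n + s))"
    by (simp only: sum.lessThan_Suc_shift) simp
  also have "\<dots> = (\<Sum>n<T. f (n + s)) + f s"
    using assms[of s] by (simp add: add.commute)
  finally show ?case using Suc by simp
qed simp

text \<open>The last \<open>T\<close> terms form a full period and cancel; removing such blocks
  leaves fewer than \<open>T\<close> terms of norm at most 1.\<close>

lemma norm_sum_periodic_le:
  fixes f :: "nat \<Rightarrow> 'a::real_normed_vector"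
  assumes per: "\<And>n. f (n + T) = f n" and zero: "(\<Sum>n<T. f n) = 0"
    and bound: "\<And>n. norm (f n) \<le> 1" and "T > 0"
  shows "norm (\<Sum>n=1..M. f n) \<le> T"
proof (induction M rule: less_induct)
  case (less M)
  show ?case
  proof (cases "M < T")
    case True
    have "norm (\<Sum>n=1..M. f n) \<le> (\<Sum>n=1..M. 1)"
      by (intro sum_norm_le bound)
    then show ?thesis using True by simp
  next
    case False
    have split: "{1..M} = {1..M - T} \<union> {M - T + 1..M}" using False by auto
    have "(\<Sum>n=1..M. f n) = (\<Sum>n=1..M - T. f n) + (\<Sum>n=M - T + 1..M. f n)"
      unfolding split by (rule sum.union_disjoint) auto
    also have "(\<Sum>n=M - T + 1..M. f n) = (\<Sum>n<T. f (n + (M - T + 1)))"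
      using False
      by (intro sum.reindex_bij_witness[of _ "\<lambda>n. n + (M - T + 1)" "\<lambda>n. n - (M - T + 1)"]) auto
    also have "\<dots> = 0"
      using sum_periodic_shift[of f T "M - T + 1"] per zero by simp
    finally show ?thesis using less[of "M - T"] False \<open>T > 0\<close> by simp
  qed
qed

text \<open>This is the binomial theorem modulo \<open>B\<^sup>2\<close>. When the modulus divides
  \<open>B\<^sup>2\<close>, phases become linear in \<open>h\<close>.\<close>

lemma power_1_plus_cong_linear:
  fixes B :: int
  shows "B\<^sup>2 dvd (1 + B) ^ h - (1 + int h * B)"
proof (induction h)
  case (Suc h)
  have "(1 + B) ^ Suc h - (1 + int (Suc h) * B) =
      (1 + B) * ((1 + B) ^ h - (1 + int h * B)) + int h * B\<^sup>2"
    by (simp add: algebra_simps power2_eq_square)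
  then show ?case using Suc by simp
qed simp

lemma card_multiples_le:
  assumes "k > 0"
  shows "real (card {d\<in>{1..<H}. k dvd d}) \<le> real H / real k"
proof -
  have "{d\<in>{1..<H}. k dvd d} \<subseteq> (\<lambda>i. k * i) ` {1..H div k}"
  proof
    fix d assume "d \<in> {d\<in>{1..<H}. k dvd d}"
    then obtain i where "d = k * i" "1 \<le> d" "d < H" by auto
    then show "d \<in> (\<lambda>i. k * i) ` {1..H div k}"
      using assms by (auto simp: less_eq_div_iff_mult_less_eq mult.commute intro!: imageI)
  qed
  then have "card {d\<in>{1..<H}. k dvd d} \<le> card {1..H div k}"
    by (meson card_image_le card_mono finite_atLeastAtMost finite_imageI order_trans)
  then have "real (card {d\<in>{1..<H}. k dvd d}) \<le> real (H div k)" by simp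
  also have "\<dots> \<le> real H / real k" using of_int_floor_le[of "real H / real k"]
    by (simp add: floor_divide_of_nat_eq)
  finally show ?thesis .
qed

text \<open>A \<open>p\<close>-part exceeding \<open>g\<close> forces divisibility by the least
  power of \<open>p\<close> exceeding \<open>g\<close>, and multiples of that power are
  rare.\<close>

lemma card_large_prime_power_part_le:
  assumes p: "prime p" and "g > 0"
  shows "real (card {d\<in>{1..<H}. g < p ^ multiplicity p d}) \<le> real H / real g"
proof -
  have s: "g < p ^ g"
    using prime_gt_1_nat[OF p] power_gt_expt[of p g] by simp
  define s' where "s' = (LEAST s. g < p ^ s)"
  have s': "g < p ^ s'" unfolding s'_def using s by (rule LeastI[of "\<lambda>s. g < p ^ s"])
  have "{d\<in>{1..<H}. g < p ^ multiplicity p d} \<subseteq> {d\<in>{1..<H}. p ^ s' dvd d}"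
    by (auto intro!: multiplicity_dvd' simp: s'_def Least_le)
  then have "card {d\<in>{1..<H}. g < p ^ multiplicity p d} \<le> card {d\<in>{1..<H}. p ^ s' dvd d}"
    by (intro card_mono) auto
  also have "real \<dots> \<le> real H / real (p ^ s')"
    using prime_gt_0_nat[OF p] by (intro card_multiples_le) auto
  also have "\<dots> \<le> real H / real g"
    using s' \<open>g > 0\<close> prime_gt_0_nat[OF p] by (intro divide_left_mono) (auto simp flip: of_nat_power)
  finally show ?thesis by simp
qed

section \<open>Smooth numbers and their divisors\<close>

lemma smooth_over_dvd: "m \<in> \<nat>\<^bsub>P\<^esub> \<Longrightarrow> d dvd m \<Longrightarrow> d \<in> \<nat>\<^bsub>P\<^esub>"
  by (auto simp: smooth_over_def intro: dvd_trans Nat.gr0I)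

lemma smooth_over_pos: "m \<in> \<nat>\<^bsub>P\<^esub> \<Longrightarrow> m > 0"
  by (simp add: smooth_over_def)

lemma smooth_over_dvdI:
  assumes "m \<in> \<nat>\<^bsub>P\<^esub>" "n > 0" "\<And>p. p \<in> P \<Longrightarrow> prime p \<Longrightarrow> multiplicity p m \<le> multiplicity p n"
  shows "m dvd n"
proof (rule multiplicity_le_imp_dvd)
  fix p :: nat assume "prime p"
  then show "multiplicity p m \<le> multiplicity p n"
    using assms by (cases "p dvd m") (auto simp: smooth_over_def not_dvd_imp_multiplicity_0)
qed (use assms smooth_over_pos in auto)

lemma smooth_over_eq_prod:
  assumes "m \<in> \<nat>\<^bsub>P\<^esub>" "finite P" "\<And>p. p \<in> P \<Longrightarrow> prime p"
  shows "m = (\<Prod>p\<in>P. p ^ multiplicity p m)"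
proof -
  have "m = (\<Prod>p\<in>prime_factors m. p ^ multiplicity p m)"
    using assms(1) by (simp add: prod_prime_factors smooth_over_def)
  also have "\<dots> = (\<Prod>p\<in>P. p ^ multiplicity p m)"
    using assms by (intro prod.mono_neutral_left)
      (auto simp: smooth_over_def in_prime_factors_iff not_dvd_imp_multiplicity_0)
  finally show ?thesis .
qed

text \<open>Unless the least divisor \<open>q\<close> reaching \<open>X\<close> is 1, removing one
  prime factor, of size at most \<open>B\<close>, must bring it below \<open>X\<close>.\<close>

lemma smooth_over_divisor_between:
  fixes X B :: real
  assumes m: "m \<in> \<nat>\<^bsub>P\<^esub>" and B: "\<And>p. p \<in> P \<Longrightarrow> real p \<le> B" "B \<ge> 1"
    and X: "1 \<le> X" "X \<le> real m"
  obtains q where "q dvd m" "X \<le> real q" "real q \<le> B * X"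
proof -
  define q where "q = (LEAST q. q dvd m \<and> X \<le> real q)"
  have q: "q dvd m \<and> X \<le> real q"
    unfolding q_def by (rule LeastI[of _ m]) (use X in auto)
  have "real q \<le> B * X"
  proof (cases "q = 1")
    case True
    then show ?thesis using B X mult_mono[of 1 B 1 X] by simp
  next
    case False
    then obtain p where p: "prime p" "p dvd q" using prime_factor_nat by blast
    then obtain t where t: "q = p * t" by auto
    have "p \<in> P" using m p q by (auto simp: smooth_over_def intro: dvd_trans)
    have "q > 0" using q m smooth_over_pos dvd_pos_nat by blast
    then have "t < q" using t p prime_gt_1_nat[of p] by simp
    then have "\<not> (t dvd m \<and> X \<le> real t)" unfolding q_def using not_less_Least by blast
    moreover have "t dvd m" using t q by auto
    ultimately have "real t \<le> X" by simp
    then show ?thesis using t B(1)[OF \<open>p \<in> P\<close>] X by (auto intro!: mult_mono)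
  qed
  then show ?thesis using q that by blast
qed

subsection \<open>Sums over powers of a fixed base\<close>

text \<open>Coprimality of \<open>b\<close> to the primes in \<open>P\<close> enters through
  \<open>square_dvd\<close>, from which \<open>coprime_b\<close> recovers it. The squares let
  lifting the exponent cover the prime 2.\<close>

locale smooth_power_sums =
  fixes P :: "nat set" and b \<tau> :: nat
  assumes finite_P: "finite P"
    and prime_P: "\<And>p. p \<in> P \<Longrightarrow> prime p"
    and b_ge_2: "b \<ge> 2"
    and \<tau>_pos: "\<tau> > 0"
    and square_dvd: "\<And>p. p \<in> P \<Longrightarrow> p\<^sup>2 dvd b ^ \<tau> - 1"
begin

text \<open>This is the \<open>P\<close>-part of \<open>b ^ \<tau> - 1\<close>. A smooth modulus
  above it contains some prime to a higher power, which forces cancellation over a full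
  period.\<close>

definition conductor :: nat where
  "conductor = (\<Prod>p\<in>P. p ^ multiplicity p (b ^ \<tau> - 1))"

definition S :: "int \<Rightarrow> nat \<Rightarrow> nat \<Rightarrow> complex" where
  "S a m M = (\<Sum>n=1..M. unit_char m (a * int b ^ n))"

lemma power_ge_2: "n > 0 \<Longrightarrow> b ^ n \<ge> 2"
  using b_ge_2 one_less_power[of b n] by linarith

lemma power_diff_1_pos: "n > 0 \<Longrightarrow> b ^ n - 1 > 0"
  using power_ge_2[of n] by linarith

lemma conductor_pos: "conductor > 0"
  unfolding conductor_def using prime_P by (intro prod_pos) (simp add: prime_gt_0_nat)

lemma multiplicity_power:
  assumes "p \<in> P" "n > 0"
  shows "multiplicity p (b ^ (\<tau> * n) - 1) = multiplicity p (b ^ \<tau> - 1) + multiplicity p n"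
  using multiplicity_power_diff_1[OF prime_P[OF assms(1)] power_ge_2[OF \<tau>_pos] square_dvd[OF assms(1)] assms(2)]
  by (simp add: power_mult)

lemma multiplicity_base_ge_2:
  assumes "p \<in> P"
  shows "multiplicity p (b ^ \<tau> - 1) \<ge> 2"
  using square_dvd[OF assms] prime_P[OF assms] power_diff_1_pos[OF \<tau>_pos]
  by (intro multiplicity_geI) auto

text \<open>By lifting the exponent, each prime of \<open>P\<close> occurs in
  \<open>b ^ (\<tau> * q) - 1\<close> at least as often as in \<open>q\<close>. Hence
  \<open>\<tau> * q\<close> is a period of the powers of \<open>b\<close> modulo
  \<open>q\<close>.\<close>

lemma dvd_power_diff_1:
  assumes "q \<in> \<nat>\<^bsub>P\<^esub>"
  shows "q dvd b ^ (\<tau> * q) - 1"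
  using assms \<tau>_pos smooth_over_pos[OF assms]
  by (intro smooth_over_dvdI[OF assms] power_diff_1_pos) (simp_all only: multiplicity_power, simp_all)

lemma coprime_b:
  assumes "m \<in> \<nat>\<^bsub>P\<^esub>"
  shows "coprime b m"
proof (rule ccontr)
  assume "\<not> coprime b m"
  then obtain c where c: "c dvd b" "c dvd m" "c \<noteq> 1"
    by (auto elim: not_coprimeE)
  obtain p where "prime p" "p dvd c" using prime_factor_nat[OF c(3)] by blast
  with c have p: "prime p" "p dvd b" "p dvd m" by auto
  then have "p \<in> P" using assms by (auto simp: smooth_over_def)
  then have "p dvd b ^ \<tau> - 1"
    using square_dvd by (meson dvd_power dvd_trans zero_less_numeral)
  moreover have "p dvd b ^ \<tau>" using dvd_trans[OF p(2) dvd_power[of \<tau> b]] \<tau>_pos by blast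
  ultimately have "p dvd 1"
    using power_ge_2[OF \<tau>_pos] by (metis dvd_diffD1 le_trans one_le_numeral)
  then show False using p by simp
qed

section \<open>Periodicity and vanishing of complete sums\<close>

lemma unit_char_periodic:
  assumes "m \<in> \<nat>\<^bsub>P\<^esub>"
  shows "unit_char m (a * int b ^ (n + \<tau> * m)) = unit_char m (a * int b ^ n)"
proof (rule unit_char_cong)
  have "int m dvd int (b ^ (\<tau> * m) - 1)"
    using dvd_power_diff_1[OF assms] by (simp only: of_nat_dvd_iff)
  also have "\<dots> dvd a * int b ^ (n + \<tau> * m) - a * int b ^ n"
  proof
    show "a * int b ^ (n + \<tau> * m) - a * int b ^ n = int (b ^ (\<tau> * m) - 1) * (a * int b ^ n)"
      using b_ge_2 by (simp add: of_nat_diff algebra_simps power_add)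
  qed
  finally show "int m dvd a * int b ^ (n + \<tau> * m) - a * int b ^ n" .
qed (use assms smooth_over_pos in auto)

text \<open>Translation by multiples of \<open>\<tau> * q\<close>, for a suitable divisor
  \<open>q\<close> of \<open>m\<close>, preserves the complete sum. Averaging over \<open>p\<close>
  translations multiplies each term by the sum of all powers of a nontrivial \<open>p\<close>-th
  root of unity, which is 0.\<close>

lemma full_period_sum_eq_0:
  assumes m: "m \<in> \<nat>\<^bsub>P\<^esub>" "m > conductor" and a: "coprime a (int m)"
  shows "(\<Sum>n<\<tau> * m. unit_char m (a * int b ^ n)) = 0"
proof -
  have "\<exists>p\<in>P. multiplicity p (b ^ \<tau> - 1) < multiplicity p m"
  proof (rule ccontr)
    assume "\<not> ?thesis"
    then have "(\<Prod>p\<in>P. p ^ multiplicity p m) \<le> conductor"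
      unfolding conductor_def using prime_P prime_gt_0_nat
      by (intro prod_mono) (auto intro!: power_increasing simp: not_less Suc_le_eq)
    with m smooth_over_eq_prod[OF m(1) finite_P prime_P] show False by simp
  qed
  then obtain p where p: "p \<in> P" "multiplicity p (b ^ \<tau> - 1) < multiplicity p m" by blast
  define w where "w = multiplicity p (b ^ \<tau> - 1)"
  have w: "w \<ge> 2" "w < multiplicity p m" using p multiplicity_base_ge_2 by (auto simp: w_def)
  have pp: "prime p" using p prime_P by simp
  have m0: "m > 0" using m smooth_over_pos by simp
  \<comment> \<open>For this \<open>q\<close> the shift \<open>\<tau> q\<close> multiplies each term by a nontrivial \<open>p\<close>-th root of unity \<open>\<zeta> n\<close>.\<close>
  obtain q where q: "m = p ^ Suc w * q"
    using w by (metis Suc_leI multiplicity_dvd' dvd_def)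
  have q0: "q > 0" using q m0 by (cases q) auto
  have qP: "q \<in> \<nat>\<^bsub>P\<^esub>" using m(1) by (rule smooth_over_dvd) (simp add: q)
  have mq: "multiplicity l m = (if l = p then Suc w else 0) + multiplicity l q" if "prime l" for l
  proof -
    have "multiplicity l m = multiplicity l (p ^ Suc w) + multiplicity l q"
      unfolding q using that q0 pp by (intro prime_elem_multiplicity_mult_distrib) auto
    then show ?thesis using that pp 
      by (auto simp: prime_multiplicity_other multiplicity_same_power prime_gt_0_nat multiplicity_distinct_prime_power
          simp del: power_Suc)
  qed
  define B where "B = b ^ (\<tau> * q) - 1"
  have B0: "B > 0" unfolding B_def using \<tau>_pos q0 by (intro power_diff_1_pos) auto
  have b_eq: "b ^ (\<tau> * q) = 1 + B"
    using power_ge_2[of "\<tau> * q"] \<tau>_pos q0 by (simp add: B_def)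
  \<comment> \<open>Having one factor \<open>p\<close> fewer than \<open>m\<close>, \<open>B\<close>
    is not divisible by \<open>m\<close>, while \<open>p * B\<close> turns out to be. This is what
    gives each \<open>\<zeta> n\<close> order \<open>p\<close>.\<close>
  have mB: "multiplicity p B = multiplicity p m - 1"
    using multiplicity_power[OF p(1) q0] mq[OF pp] by (simp add: B_def w_def)
  have not_dvd: "\<not> m dvd B"
  proof
    assume "m dvd B"
    then have "multiplicity p m \<le> multiplicity p B"
      using B0 by (intro dvd_imp_multiplicity_le) auto
    then show False using mB w by linarith
  qed
  have dvd: "m dvd p * B"
  proof (rule smooth_over_dvdI[OF m(1)])
    fix l assume l: "l \<in> P" "prime l"
    have "multiplicity l (p * B) = multiplicity l p + multiplicity l B"
      using l pp B0 prime_gt_0_nat[OF pp] by (intro prime_elem_multiplicity_mult_distrib) auto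
    moreover have "multiplicity l B \<ge> multiplicity l q"
      using multiplicity_power[OF l(1) q0] by (simp add: B_def)
    ultimately show "multiplicity l m \<le> multiplicity l (p * B)"
      using mq[OF l(2)] mB w pp by (auto simp: prime_gt_1_nat multiplicity_self)
  qed (use B0 pp prime_gt_0_nat in auto)
  \<comment> \<open>Then \<open>m\<close> divides \<open>p * B\<close> and hence
    \<open>B\<^sup>2\<close>, so the terms of \<open>(1 + B) ^ h\<close> beyond the linear one
    vanish modulo \<open>m\<close>.\<close>
  have "p dvd B"
    using mB w not_dvd_imp_multiplicity_0[of p B] by linarith
  then have "m dvd B\<^sup>2" using dvd by (metis dvd_trans mult_dvd_mono dvd_refl power2_eq_square)
  then have dvd2: "int m dvd (int B)\<^sup>2" by (metis of_nat_dvd_iff of_nat_power)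
  define f where "f = (\<lambda>n. unit_char m (a * int b ^ n))"
  define \<zeta> where "\<zeta> = (\<lambda>n. unit_char m (a * int b ^ n * int B))"
  have shift: "f (n + h * (\<tau> * q)) = f n * \<zeta> n ^ h" for n h
  proof -
    have "f (n + h * (\<tau> * q)) = unit_char m (a * int b ^ n * (1 + int B) ^ h)"
    proof -
      have "int b ^ (h * (\<tau> * q)) = int ((b ^ (\<tau> * q)) ^ h)"
        by (simp add: mult.commute[of h] power_mult)
      then have "int b ^ (h * (\<tau> * q)) = (1 + int B) ^ h"
        by (simp add: b_eq)
      then show ?thesis by (simp only: f_def power_add mult.assoc)
    qed
    also have "\<dots> = unit_char m (a * int b ^ n * (1 + int h * int B))"
    proof (rule unit_char_cong[OF m0])
      show "int m dvd a * int b ^ n * (1 + int B) ^ h - a * int b ^ n * (1 + int h * int B)"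
        using dvd_trans[OF dvd2 power_1_plus_cong_linear[of "int B" h]]
        by (metis dvd_mult right_diff_distrib)
    qed
    also have "\<dots> = unit_char m (a * int b ^ n + of_nat h * (a * int b ^ n * int B))"
      by (simp add: algebra_simps)
    also have "\<dots> = f n * \<zeta> n ^ h"
      by (simp only: unit_char_add unit_char_of_nat_mult f_def \<zeta>_def)
    finally show ?thesis .
  qed
  have geom: "(\<Sum>h<p. \<zeta> n ^ h) = 0" for n
  proof -
    have "\<zeta> n ^ p = unit_char m (of_nat p * (a * int b ^ n * int B))"
      by (simp only: unit_char_of_nat_mult \<zeta>_def)
    also have "\<dots> = 1"
    proof -
      have "int m dvd int (p * B)" using dvd by (simp only: of_nat_dvd_iff)
      then have "int m dvd int (p * B) * (a * int b ^ n)" by (rule dvd_mult2)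
      also have "\<dots> = of_nat p * (a * int b ^ n * int B)" by (simp add: mult_ac)
      finally show ?thesis using m0 by (simp only: unit_char_eq_1_iff)
    qed
    finally have 1: "\<zeta> n ^ p = 1" .
    have 2: "\<zeta> n \<noteq> 1"
    proof
      assume "\<zeta> n = 1"
      then have "int m dvd (a * int b ^ n) * int B"
        using m0 by (simp add: \<zeta>_def unit_char_eq_1_iff)
      moreover have "coprime (int m) (a * int b ^ n)"
        using a coprime_b[OF m(1)] by (simp add: coprime_commute)
      ultimately have "int m dvd int B" using coprime_dvd_mult_right_iff by blast
      then show False using not_dvd by simp
    qed
    show ?thesis using 1 2 by (simp add: geometric_sum)
  qed
  have "of_nat p * (\<Sum>n<\<tau> * m. f n) = (\<Sum>h<p. \<Sum>n<\<tau> * m. f (n + h * (\<tau> * q)))"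
  proof -
    have "(\<Sum>n<\<tau> * m. f (n + h * (\<tau> * q))) = (\<Sum>n<\<tau> * m. f n)" for h
      using unit_char_periodic[OF m(1)] by (intro sum_periodic_shift) (simp add: f_def)
    then show ?thesis by simp
  qed
  also have "\<dots> = (\<Sum>n<\<tau> * m. f n * (\<Sum>h<p. \<zeta> n ^ h))"
    by (subst sum.swap) (simp add: shift sum_distrib_left)
  also have "\<dots> = 0" by (simp add: geom)
  finally show ?thesis using pp prime_gt_0_nat[OF pp] by (simp add: f_def)
qed

lemma norm_S_le_period:
  assumes "m \<in> \<nat>\<^bsub>P\<^esub>" "m > conductor" "coprime a (int m)"
  shows "cmod (S a m M) \<le> real (\<tau> * m)"
  unfolding S_def
  using assms \<tau>_pos
  by (intro norm_sum_periodic_le full_period_sum_eq_0)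
     (auto simp: unit_char_periodic smooth_over_pos)

section \<open>One van der Corput step for \<open>S\<close>\<close>

definition bad :: "nat \<Rightarrow> nat \<Rightarrow> nat set" where
  "bad g H = {d\<in>{1..<H}. \<exists>p\<in>P. g < p ^ multiplicity p d}"

lemma card_bad_le:
  assumes "g > 0"
  shows "real (card (bad g H)) \<le> real (card P) * real H / real g"
proof -
  have "bad g H = (\<Union>p\<in>P. {d\<in>{1..<H}. g < p ^ multiplicity p d})"
    by (auto simp: bad_def)
  then have "card (bad g H) \<le> (\<Sum>p\<in>P. card {d\<in>{1..<H}. g < p ^ multiplicity p d})"
    using finite_P by (simp add: card_UN_le)
  then have "real (card (bad g H)) \<le> (\<Sum>p\<in>P. real (card {d\<in>{1..<H}. g < p ^ multiplicity p d}))"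
    by (simp flip: of_nat_sum)
  also have "\<dots> \<le> (\<Sum>p\<in>P. real H / real g)"
    using prime_P assms by (intro sum_mono card_large_prime_power_part_le)
  finally show ?thesis by simp
qed

text \<open>Lifting the exponent splits each prime's exponent into contributions of
  \<open>b ^ \<tau> - 1\<close>, \<open>q\<close> and \<open>d\<close>. The first two multiply to
  \<open>conductor\<close> and \<open>q\<close>; the third costs at most \<open>g\<close> per
  prime.\<close>

lemma gcd_shift_le:
  assumes m: "m \<in> \<nat>\<^bsub>P\<^esub>" and q: "q dvd m" and d: "d > 0"
    and small: "\<And>p. p \<in> P \<Longrightarrow> p ^ multiplicity p d \<le> g"
  shows "gcd (b ^ (\<tau> * q * d) - 1) m \<le> conductor * q * g ^ card P"
proof -
  let ?B = "b ^ (\<tau> * q * d) - 1"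
  have qP: "q \<in> \<nat>\<^bsub>P\<^esub>" using m q by (rule smooth_over_dvd)
  then have q0: "q > 0" by (rule smooth_over_pos)
  have B0: "?B > 0" using q0 d \<tau>_pos by (intro power_diff_1_pos) auto
  have gP: "gcd ?B m \<in> \<nat>\<^bsub>P\<^esub>" using m by (rule smooth_over_dvd) simp
  have "gcd ?B m = (\<Prod>p\<in>P. p ^ multiplicity p (gcd ?B m))"
    by (rule smooth_over_eq_prod[OF gP finite_P prime_P])
  also have "\<dots> \<le> (\<Prod>p\<in>P. p ^ multiplicity p (b ^ \<tau> - 1) * p ^ multiplicity p q * g)"
  proof (intro prod_mono conjI)
    fix p assume p: "p \<in> P"
    have pp: "prime p" using p prime_P by simp
    have "multiplicity p (gcd ?B m) \<le> multiplicity p ?B"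
      using B0 by (intro dvd_imp_multiplicity_le) auto
    also have "\<dots> = multiplicity p (b ^ \<tau> - 1) + multiplicity p (q * d)"
      using multiplicity_power[OF p, of "q * d"] q0 d by (simp add: mult.assoc)
    also have "multiplicity p (q * d) = multiplicity p q + multiplicity p d"
      using pp q0 d by (intro prime_elem_multiplicity_mult_distrib) auto
    finally have "p ^ multiplicity p (gcd ?B m) \<le>
        p ^ (multiplicity p (b ^ \<tau> - 1) + (multiplicity p q + multiplicity p d))"
      using prime_gt_0_nat[OF pp] by (intro power_increasing) auto
    also have "\<dots> \<le> p ^ multiplicity p (b ^ \<tau> - 1) * p ^ multiplicity p q * g"
      using small[OF p] by (simp add: power_add)
    finally show "p ^ multiplicity p (gcd ?B m) \<le>
      p ^ multiplicity p (b ^ \<tau> - 1) * p ^ multiplicity p q * g" .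
  qed auto
  also have "\<dots> = conductor * q * g ^ card P"
    using smooth_over_eq_prod[OF qP finite_P prime_P] by (simp add: prod.distrib conductor_def)
  finally show ?thesis .
qed

text \<open>The difference of phases has numerator \<open>a * B * b ^ i\<close>, and reducing
  \<open>B / m\<close> to lowest terms yields \<open>m'\<close>. The removed gcd is a multiple of
  \<open>q\<close> and is bounded by \<open>gcd_shift_le\<close>, so \<open>m'\<close> is
  \<open>m / q\<close> up to controlled factors.\<close>

lemma shift_correlation:
  assumes m: "m \<in> \<nat>\<^bsub>P\<^esub>" and a: "coprime a (int m)" and q: "q dvd m" and d: "d > 0"
    and small: "\<And>p. p \<in> P \<Longrightarrow> p ^ multiplicity p d \<le> g"
  obtains a' m' where "m' \<in> \<nat>\<^bsub>P\<^esub>" "coprime a' (int m')"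
    "q * m' \<le> m" "m \<le> conductor * q * g ^ card P * m'"
    "\<And>M. (\<Sum>i=1..M. unit_char m (a * int b ^ (i + d * (\<tau> * q))) * cnj (unit_char m (a * int b ^ i)))
          = S a' m' M"
proof -
  define B where "B = b ^ (\<tau> * q * d) - 1"
  define D where "D = gcd B m"
  have m0: "m > 0" using m by (rule smooth_over_pos)
  have qP: "q \<in> \<nat>\<^bsub>P\<^esub>" using m q by (rule smooth_over_dvd)
  have q0: "q > 0" using qP by (rule smooth_over_pos)
  have b_eq: "b ^ (\<tau> * q * d) = 1 + B"
    using power_ge_2[of "\<tau> * q * d"] \<tau>_pos q0 d by (simp add: B_def)
  have D0: "D > 0" using m0 by (simp add: D_def)
  obtain B' m' where "B = B' * D" "m = m' * D" "coprime B' m'"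
    using gcd_coprime_exists[of B m] D0 unfolding D_def[symmetric] by blast
  then have B': "B = D * B'" "m = D * m'" "coprime B' m'"
    by (simp_all only: mult.commute)
  show ?thesis
  proof (rule that)
    show "m' \<in> \<nat>\<^bsub>P\<^esub>" using m by (rule smooth_over_dvd) (rule dvdI[OF B'(2)[unfolded mult.commute[of D]]])
    have "coprime a (int m')" using a unfolding B'(2) by simp
    moreover have "coprime (int B') (int m')" using B'(3) by simp
    ultimately show "coprime (a * int B') (int m')" by simp
    have "q dvd b ^ (\<tau> * q) - 1" by (rule dvd_power_diff_1[OF qP])
    also have "\<dots> dvd (b ^ (\<tau> * q)) ^ d - 1"
      using b_ge_2 by (subst power_eq_1_plus_geometric_sum[of "b ^ (\<tau> * q)" d]) auto
    finally have "q dvd B" by (simp add: B_def power_mult)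
    then have "q dvd D" using q by (simp add: D_def)
    then have "q \<le> D" using D0 by (intro dvd_imp_le)
    then show "q * m' \<le> m" unfolding B'(2) by (intro mult_right_mono) auto
    have "D \<le> conductor * q * g ^ card P"
      unfolding D_def B_def using m q d small by (rule gcd_shift_le)
    then show "m \<le> conductor * q * g ^ card P * m'"
      unfolding B'(2) by (intro mult_right_mono) auto
    fix M
    have "unit_char m (a * int b ^ (i + d * (\<tau> * q))) * cnj (unit_char m (a * int b ^ i))
        = unit_char m' (a * int B' * int b ^ i)" for i
    proof -
      have "int b ^ (d * (\<tau> * q)) = int (b ^ (\<tau> * q * d))"
        by (simp add: mult.commute)
      then have b_eq': "int b ^ (d * (\<tau> * q)) = 1 + int B"
        by (simp add: b_eq)
      have "unit_char m (a * int b ^ (i + d * (\<tau> * q))) * cnj (unit_char m (a * int b ^ i)) =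
          unit_char m (a * int b ^ (i + d * (\<tau> * q)) + - (a * int b ^ i))"
        by (simp only: cnj_unit_char unit_char_add)
      also have "a * int b ^ (i + d * (\<tau> * q)) + - (a * int b ^ i) = int D * (a * int B' * int b ^ i)"
        unfolding power_add b_eq' B'(1) by (simp add: algebra_simps)
      also have "unit_char m \<dots> = unit_char m' (a * int B' * int b ^ i)"
        unfolding B'(2) by (rule unit_char_cancel[OF D0])
      finally show ?thesis .
    qed
    then show "(\<Sum>i=1..M. unit_char m (a * int b ^ (i + d * (\<tau> * q))) * cnj (unit_char m (a * int b ^ i)))
          = S (a * int B') m' M"
      by (simp add: S_def)
  qed
qed

text \<open>The three terms come from the zero shift, the shifts in \<open>bad g H\<close>, and the
  remaining shifts, which \<open>IH\<close> covers. Bounds relative to \<open>N\<close> rather than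
  to the length survive the truncation to \<open>M - d * (\<tau> * q)\<close>.\<close>

lemma S_van_der_corput_step:
  fixes \<epsilon> :: real
  assumes m: "m \<in> \<nat>\<^bsub>P\<^esub>" and a: "coprime a (int m)" and q: "q dvd m"
    and H: "H > 0" "H * (\<tau> * q) \<le> N" and M: "M \<le> N" and g: "g > 0" and \<epsilon>: "\<epsilon> \<ge> 0"
    and IH: "\<And>a' m' M'. m' \<in> \<nat>\<^bsub>P\<^esub> \<Longrightarrow> coprime a' (int m') \<Longrightarrow> q * m' \<le> m \<Longrightarrow>
      m \<le> conductor * q * g ^ card P * m' \<Longrightarrow> M' \<le> N \<Longrightarrow> cmod (S a' m' M') \<le> \<epsilon> * N"
  shows "(cmod (S a m M))\<^sup>2 \<le> (real N)\<^sup>2 * (2 / H + 4 * card P / g + 4 * \<epsilon>)"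
proof -
  define f where "f = (\<lambda>n. unit_char m (a * int b ^ n))"
  define C where "C = (\<lambda>d. if d = 0 \<or> d \<in> bad g H then real N else \<epsilon> * N)"
  have "(cmod (\<Sum>n=1..M. f n))\<^sup>2 \<le> 2 * N / H * (C 0 + 2 * (\<Sum>d\<in>{1..<H}. C d))"
  proof (rule van_der_corput[OF H(1)])
    have "real M + real (H * (\<tau> * q)) \<le> real N + real N"
      using M H(2) by (intro add_mono) (simp_all only: of_nat_le_iff)
    then show "real M + real (H * (\<tau> * q)) \<le> 2 * N" by simp
    show "C d \<ge> 0" for d using \<epsilon> by (simp add: C_def)
    show "cmod (\<Sum>i=1..M - d * (\<tau> * q). f (i + d * (\<tau> * q)) * cnj (f i)) \<le> C d" if "d < H" for d
    proof (cases "d = 0 \<or> d \<in> bad g H")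
      case True
      have "cmod (\<Sum>i=1..M - d * (\<tau> * q). f (i + d * (\<tau> * q)) * cnj (f i)) \<le>
          (\<Sum>i=1..M - d * (\<tau> * q). 1)"
        by (intro sum_norm_le) (simp add: f_def norm_mult)
      also have "\<dots> \<le> real N" using M by simp
      finally show ?thesis using True by (simp add: C_def)
    next
      case False
      then have d: "d > 0" "\<And>p. p \<in> P \<Longrightarrow> p ^ multiplicity p d \<le> g"
        using that by (auto simp: bad_def not_less Suc_le_eq)
      show ?thesis
      proof (rule shift_correlation[OF m a q d])
        fix a' m'
        assume *: "m' \<in> \<nat>\<^bsub>P\<^esub>" "coprime a' (int m')" "q * m' \<le> m" "m \<le> conductor * q * g ^ card P * m'"
          "\<And>M. (\<Sum>i=1..M. unit_char m (a * int b ^ (i + d * (\<tau> * q))) * cnj (unit_char m (a * int b ^ i)))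
            = S a' m' M"
        show "cmod (\<Sum>i=1..M - d * (\<tau> * q). f (i + d * (\<tau> * q)) * cnj (f i)) \<le> C d"
          using IH[OF *(1-4), of "M - d * (\<tau> * q)"] M False unfolding f_def *(5) by (simp add: C_def)
      qed
    qed
  qed
  also have "(\<Sum>d\<in>{1..<H}. C d) \<le> real N * (card P * H / g) + H * (\<epsilon> * N)"
  proof -
    have "(\<Sum>d\<in>{1..<H}. C d) \<le> (\<Sum>d\<in>{1..<H}. (if d \<in> bad g H then real N else 0) + \<epsilon> * N)"
      using \<epsilon> by (intro sum_mono) (auto simp: C_def)
    also have "\<dots> = real N * card (bad g H) + real (card {1..<H}) * (\<epsilon> * N)"
    proof -
      have "bad g H \<subseteq> {1..<H}" by (auto simp: bad_def)
      then show ?thesis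
        by (simp add: sum.distrib sum.If_cases Int_absorb1)
    qed
    also have "\<dots> \<le> real N * (card P * H / g) + H * (\<epsilon> * N)"
      using card_bad_le[OF g, of H] \<epsilon> by (intro add_mono mult_left_mono mult_right_mono) auto
    finally show ?thesis .
  qed
  also have "2 * N / H * (C 0 + 2 * (real N * (card P * H / g) + H * (\<epsilon> * N))) =
      (real N)\<^sup>2 * (2 / H + 4 * card P / g + 4 * \<epsilon>)"
    using H(1) g by (simp add: C_def field_simps power2_eq_square)
  finally show ?thesis
    by (simp add: S_def f_def divide_right_mono mult_left_mono)
qed

text \<open>The factor \<open>\<tau> * B\<close> keeps \<open>N / (\<tau> * B)\<close> at least 1.
  The rest is \<open>conductor\<close> times the constant lost when a step bounds the new modulus
  from below, so that this modulus stays above \<open>conductor\<close>.\<close>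

definition threshold :: "real \<Rightarrow> real" where
  "threshold B = real \<tau> * B * (real conductor * (real conductor * B * real (card P + 2) ^ card P))"

lemma threshold_factor_ge_1:
  assumes "B \<ge> 1"
  shows "1 \<le> real conductor * (real conductor * B * real (card P + 2) ^ card P)"
proof -
  have mult: "1 \<le> x * y" if "1 \<le> x" "1 \<le> y" for x y :: real
    using mult_mono[of 1 x 1 y] that by simp
  have "1 \<le> real conductor" using conductor_pos by simp
  moreover have "1 \<le> real (card P + 2) ^ card P" by (rule one_le_power) simp
  ultimately show ?thesis using assms by (intro mult)
qed

lemma threshold_ge:
  assumes "B \<ge> 1"
  shows "real \<tau> * B \<le> threshold B"
proof -
  have "real \<tau> * B * 1 \<le> threshold B"
    unfolding threshold_def using assms
    by (intro mult_left_mono threshold_factor_ge_1) auto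
  then show ?thesis by simp
qed

text \<open>
  \<open>\<theta> ^ 2 ^ k\<close> is unchanged when \<open>(k + 1, \<theta>)\<close> is replaced by \<open>(k, \<theta>\<^sup>2)\<close>, so the hypothesis
  \<open>large\<close> is inherited by the induction hypothesis.
\<close>
lemma norm_S_le:
  fixes \<theta> B :: real and N k :: nat
  assumes B: "\<And>p. p \<in> P \<Longrightarrow> real p \<le> B" "B \<ge> 1"
    and \<theta>: "0 < \<theta>" "\<theta> \<le> 1"
    and large: "threshold B < N * \<theta> ^ (2 ^ k * (2 * card P + 3))"
    and m: "m \<in> \<nat>\<^bsub>P\<^esub>" "conductor < m" "m \<le> (N / (\<tau> * B)) ^ Suc k * \<theta> ^ (3 * 2 ^ k - 2)"
    and a: "coprime a (int m)" and M: "M \<le> N"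
  shows "cmod (S a m M) \<le> 10 * \<theta> * N"
  using \<theta> large m a M
proof (induction k arbitrary: \<theta> m a M)
  case 0
  \<comment> \<open>The exponent \<open>3 * 2 ^ 0 - 2\<close> is 1, so a full period has length at
    most \<open>\<theta> * N / B\<close>.\<close>
  have "cmod (S a m M) \<le> real \<tau> * real m"
    using norm_S_le_period 0 by simp
  also have "\<dots> \<le> real \<tau> * (N / (\<tau> * B) * \<theta>)"
    using 0 by (intro mult_left_mono) auto
  also have "\<dots> = N * \<theta> / B" using \<tau>_pos by simp
  also have "\<dots> \<le> N * \<theta> / 1"
    using B(2) 0 by (intro divide_left_mono) auto
  also have "\<dots> \<le> 10 * \<theta> * N" using 0 by simp
  finally show ?case .
next
  case (Suc k)
  define r where "r = card P"
  define C where "C = real \<tau> * B"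
  define E where "E = (3 * 2 ^ k - 2 :: nat)"
  \<comment> \<open>\<open>Hi\<close> is the largest modulus that the induction hypothesis admits
    for \<open>\<theta>\<^sup>2\<close>.\<close>
  define Hi where "Hi = (N / C) ^ Suc k * (\<theta>\<^sup>2) ^ E"
  have C: "C > 0" using \<tau>_pos B(2) by (simp add: C_def)
  have \<theta>2: "0 < \<theta>\<^sup>2" "\<theta>\<^sup>2 \<le> 1" "\<theta>\<^sup>2 \<le> \<theta>"
    using Suc.prems by (auto simp: power_le_one power2_eq_square mult_le_one)
  have pow2: "(1::nat) \<le> 2 ^ k" by simp
  have large: "threshold B < N * (\<theta>\<^sup>2) ^ (2 ^ k * (2 * card P + 3))"
    using Suc.prems(3) by (simp add: mult_ac flip: power_mult)
  note IH = Suc.IH[OF \<theta>2(1,2) large]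
  have "N * \<theta> ^ (2 ^ Suc k * (2 * card P + 3)) \<le> real N * 1"
    using Suc.prems by (intro mult_left_mono power_le_one) auto
  then have NC: "N / C \<ge> 1"
    using threshold_ge[OF B(2)] Suc.prems(3) C by (simp add: C_def)
  have Hi_large: "real conductor * (real conductor * B * real (r + 2) ^ r) < Hi * \<theta> ^ (2 * r)"
  proof -
    have "threshold B / C < N * \<theta> ^ (2 ^ Suc k * (2 * r + 3)) / C"
      using Suc.prems(3) C by (simp add: divide_strict_right_mono r_def)
    moreover have "threshold B / C = real conductor * (real conductor * B * real (r + 2) ^ r)"
      unfolding threshold_def C_def r_def
      by (intro nonzero_mult_div_cancel_left) (use B(2) \<tau>_pos in simp)
    moreover have "N * \<theta> ^ (2 ^ Suc k * (2 * r + 3)) / C \<le> N / C * \<theta> ^ (2 * E + 2 * r)"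
    proof -
      have "1 * (2 * r) \<le> 2 ^ Suc k * (2 * r)" by (intro mult_right_mono) auto
      then have "2 * E + 2 * r \<le> 2 ^ Suc k * (2 * r + 3)"
        by (simp add: E_def algebra_simps)
      then have "\<theta> ^ (2 ^ Suc k * (2 * r + 3)) \<le> \<theta> ^ (2 * E + 2 * r)"
        using Suc.prems by (intro power_decreasing) auto
      then have "N / C * \<theta> ^ (2 ^ Suc k * (2 * r + 3)) \<le> N / C * \<theta> ^ (2 * E + 2 * r)"
        using NC by (intro mult_left_mono) auto
      then show ?thesis by simp
    qed
    moreover have "N / C * \<theta> ^ (2 * E + 2 * r) \<le> Hi * \<theta> ^ (2 * r)"
    proof -
      have "N / C \<le> (N / C) ^ Suc k"
        using power_increasing[of 1 "Suc k" "N / C"] NC by simp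
      then have "N / C * \<theta> ^ (2 * E + 2 * r) \<le> (N / C) ^ Suc k * \<theta> ^ (2 * E + 2 * r)"
        using Suc.prems by (intro mult_right_mono) auto
      then show ?thesis by (simp add: Hi_def power_add mult.assoc flip: power_mult)
    qed
    ultimately show ?thesis by linarith
  qed
  show ?case
  proof (cases "m \<le> Hi")
    case True
    then have "cmod (S a m M) \<le> 10 * \<theta>\<^sup>2 * N"
      using IH[OF Suc.prems(4,5) _ Suc.prems(7,8)] by (simp only: Hi_def C_def E_def)
    also have "\<dots> \<le> 10 * \<theta> * N"
      using \<theta>2 by (intro mult_right_mono) auto
    finally show ?thesis .
  next
    case False
    \<comment> \<open>A divisor \<open>q\<close> of size at least \<open>X\<close> brings the new
      modulus, at most \<open>m / q\<close>, down to \<open>Hi\<close>. Keeping \<open>q\<close>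
      within \<open>B * X\<close> leaves room for many shifts.\<close>
    define X where "X = m / Hi"
    have "1 \<le> real conductor * (real conductor * B * real (r + 2) ^ r)"
      unfolding r_def by (rule threshold_factor_ge_1[OF B(2)])
    moreover have "Hi * \<theta> ^ (2 * r) \<le> Hi * 1"
      using Suc.prems C by (intro mult_left_mono power_le_one) (auto simp: Hi_def)
    ultimately have Hi1: "Hi \<ge> 1" using Hi_large by linarith
    have X: "1 \<le> X" "X \<le> real m"
      using False Hi1 mult_left_mono[OF Hi1, of "real m"] by (auto simp: X_def field_simps)
    obtain q where q: "q dvd m" "X \<le> real q" "real q \<le> B * X"
      using smooth_over_divisor_between[OF Suc.prems(4) B X] by blast
    have q0: "q > 0" using q(2) X by (cases q) auto
    have m_le: "real m \<le> Hi * (\<theta>\<^sup>2 * N / C)"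
    proof -
      \<comment> \<open>The exponent obeys this recursion so that one factor
        \<open>\<theta>\<^sup>2\<close> is left over; it gives
        \<open>N / (\<tau> * q) \<ge> 1 / \<theta>\<^sup>2\<close>.\<close>
      have "(3 * 2 ^ Suc k - 2 :: nat) = 2 * E + 2"
        using pow2 unfolding E_def power_Suc by linarith
      then have "\<theta> ^ (3 * 2 ^ Suc k - 2) = (\<theta>\<^sup>2) ^ E * \<theta>\<^sup>2"
        by (simp only: power_add power_mult)
      then show ?thesis
        using Suc.prems(6) by (simp add: Hi_def C_def mult_ac)
    qed
    have \<tau>q: "real (\<tau> * q) * (1 / \<theta>\<^sup>2) \<le> N"
    proof -
      have "real (\<tau> * q) \<le> C * X"
        using q(3) by (simp add: C_def mult.assoc mult_left_mono)
      also have "\<dots> \<le> C * (\<theta>\<^sup>2 * N / C)"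
        using m_le Hi1 C by (intro mult_left_mono) (auto simp: X_def divide_le_eq mult.commute)
      also have "\<dots> = \<theta>\<^sup>2 * N" using C by simp
      finally show ?thesis using \<theta>2(1) by (simp add: field_simps)
    qed
    \<comment> \<open>This is the largest number of shifts that fits into \<open>N\<close>. As the
      quotient is at least 1, rounding down loses at most a factor 2.\<close>
    define H where "H = N div (\<tau> * q)"
    have H_real: "1 / \<theta>\<^sup>2 \<le> real N / real (\<tau> * q)"
      using \<tau>q \<tau>_pos q0 by (simp add: field_simps)
    have \<theta>inv: "1 / \<theta>\<^sup>2 \<ge> 1" using \<theta>2 by simp
    have "real N / real (\<tau> * q) < real H + 1"
      unfolding H_def using floor_correct[of "real N / real (\<tau> * q)"]
      by (simp only: floor_divide_of_nat_eq) simp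
    then have "real H > 0" using H_real \<theta>inv by linarith
    then have H0: "H > 0" by simp
    then have "2 * real H \<ge> 1 / \<theta>\<^sup>2"
      using H_real \<open>real N / real (\<tau> * q) < real H + 1\<close> by linarith
    then have H_inv: "2 / H \<le> 4 * \<theta>\<^sup>2"
      using H0 \<theta>2(1) by (simp add: field_simps)
    \<comment> \<open>This makes \<open>r / g\<close>, the bound on the proportion of bad shifts, at
      most \<open>\<theta>\<^sup>2\<close>. Adding 1 to \<open>r\<close> keeps \<open>g\<close>
      positive when \<open>P\<close> is empty.\<close>
    define g where "g = nat \<lceil>(r + 1) / \<theta>\<^sup>2\<rceil>"
    have g_lower: "(r + 1) / \<theta>\<^sup>2 \<le> g" unfolding g_def by (rule real_nat_ceiling_ge)
    have g_upper: "g \<le> (r + 2) / \<theta>\<^sup>2"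
    proof -
      have "real g \<le> (r + 1) / \<theta>\<^sup>2 + 1"
      proof -
        have "0 \<le> (r + 1) / \<theta>\<^sup>2" by simp
        then have "0 \<le> \<lceil>(r + 1) / \<theta>\<^sup>2\<rceil>"
          by (metis zero_le_ceiling less_le_trans neg_less_0_iff_less zero_less_one)
        then have "real g = of_int \<lceil>(r + 1) / \<theta>\<^sup>2\<rceil>" by (simp add: g_def)
        then show ?thesis using of_int_ceiling_le_add_one by metis
      qed
      also have "\<dots> \<le> (r + 1) / \<theta>\<^sup>2 + 1 / \<theta>\<^sup>2" using \<theta>inv by simp
      also have "\<dots> = (r + 2) / \<theta>\<^sup>2" by (simp flip: add_divide_distrib)
      finally show ?thesis .
    qed
    have "0 < (r + 1) / \<theta>\<^sup>2" using \<theta>2(1) by simp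
    then have g0: "g > 0" using g_lower by (simp only: of_nat_0_less_iff[symmetric, where 'a = real])
    have r_g: "4 * real r / g \<le> 4 * \<theta>\<^sup>2"
    proof -
      have "real r \<le> r + 1" by simp
      also have "\<dots> \<le> \<theta>\<^sup>2 * g" using g_lower \<theta>2(1) by (simp add: field_simps)
      finally show ?thesis using g0 by (simp add: field_simps)
    qed
    have "(cmod (S a m M))\<^sup>2 \<le> (real N)\<^sup>2 * (2 / H + 4 * card P / g + 4 * (10 * \<theta>\<^sup>2))"
    proof (rule S_van_der_corput_step[OF Suc.prems(4,7) q(1) H0 _ Suc.prems(8) g0])
      show "H * (\<tau> * q) \<le> N" unfolding H_def by (rule div_times_less_eq_dividend)
      fix a' m' M'
      assume m': "m' \<in> \<nat>\<^bsub>P\<^esub>" "coprime a' (int m')" "q * m' \<le> m"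
        "m \<le> conductor * q * g ^ card P * m'" "M' \<le> N"
      have "X * m' \<le> real q * m'" using q(2) by (intro mult_right_mono) auto
      also have "\<dots> \<le> real m" using m'(3) by (simp only: of_nat_mult[symmetric] of_nat_le_iff)
      also have "\<dots> = X * Hi" using Hi1 by (simp add: X_def)
      finally have upper: "m' \<le> Hi" using X by simp
      \<comment> \<open>The lower bound on \<open>m'\<close> loses the factor
        \<open>conductor * B * ((r + 2) / \<theta>\<^sup>2) ^ r\<close>. By \<open>Hi_large\<close>,
        \<open>Hi\<close> exceeds \<open>conductor\<close> times this loss.\<close>
      have "X * Hi = real m" using Hi1 by (simp add: X_def)
      also have "real m \<le> real (conductor * q * g ^ card P * m')"
        using m'(4) by (simp only: of_nat_le_iff)
      also have "\<dots> = real conductor * real q * real g ^ r * m'" by (simp add: r_def)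
      also have "\<dots> \<le> real conductor * (B * X) * ((r + 2) / \<theta>\<^sup>2) ^ r * m'"
        using q(3) g_upper X B(2) by (intro mult_mono power_mono) auto
      also have "\<dots> = X * (real conductor * B * ((r + 2) / \<theta>\<^sup>2) ^ r * m')" by simp
      finally have "Hi \<le> real conductor * B * ((r + 2) / \<theta>\<^sup>2) ^ r * m'"
        using X by simp
      then have "Hi * \<theta> ^ (2 * r) \<le> real conductor * B * ((r + 2) / \<theta>\<^sup>2) ^ r * m' * \<theta> ^ (2 * r)"
        using Suc.prems by (intro mult_right_mono) auto
      also have "\<dots> = (real conductor * B * real (r + 2) ^ r) * m'"
        using Suc.prems by (simp add: power_divide power_mult)
      finally have "(real conductor * B * real (r + 2) ^ r) * real conductor <
          (real conductor * B * real (r + 2) ^ r) * m'"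
        using Hi_large by (simp add: mult_ac)
      moreover have "real conductor * B * real (r + 2) ^ r > 0"
        using conductor_pos B(2) by simp
      ultimately have "conductor < m'"
        by (simp only: mult_less_cancel_left_pos of_nat_less_iff)
      then show "cmod (S a' m' M') \<le> 10 * \<theta>\<^sup>2 * N"
        using IH[OF m'(1) _ _ m'(2,5)] upper by (simp only: Hi_def C_def E_def)
    qed (use \<theta>2 in auto)
    \<comment> \<open>The contributions are 4, 4 and 40 times \<open>\<theta>\<^sup>2\<close>,
      within 100 times it, so the constant 10 reproduces itself.\<close>
    also have "\<dots> \<le> (real N)\<^sup>2 * (100 * \<theta>\<^sup>2)"
    proof (intro mult_left_mono)
      have "real (4 * card P) / g \<le> 4 * \<theta>\<^sup>2" using r_g by (simp add: r_def)
      then show "2 / H + real (4 * card P) / g + 4 * (10 * \<theta>\<^sup>2) \<le> 100 * \<theta>\<^sup>2"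
        using H_inv \<theta>2(1) by linarith
    qed auto
    also have "\<dots> = (10 * \<theta> * N)\<^sup>2" by (simp add: power2_eq_square)
    finally show ?thesis
      by (rule power2_le_imp_le) (use Suc.prems(1) in simp)
  qed
qed

end

subsection \<open>Choice of the parameters\<close>

text \<open>Here \<open>x\<close> stands for \<open>ln m\<close> and \<open>x / D\<close> for the
  lower bound on \<open>ln N\<close>, with \<open>D\<close>, \<open>Z\<close> and \<open>y\<close>
  as named in the proof. Since \<open>Z\<close> exceeds \<open>D\<close> by
  \<open>log 2 y / 2\<close>, the product \<open>Z * (x / D)\<close> exceeds \<open>x\<close> by at
  least \<open>2 * (x / y)\<close>: one half pays for \<open>K2\<close>, the other for the powers of
  \<open>\<theta>\<close>.\<close>

lemma eventually_parameters:
  fixes c K1 K2 :: real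
  assumes "c > 0"
  shows "eventually (\<lambda>x. ln x > 1 \<and> log 2 x - 3 * log 2 (ln x) > 0 \<and>
    log 2 x - 5 / 2 * log 2 (ln x) \<ge> 1 \<and>
    K1 < x / (log 2 x - 3 * log 2 (ln x)) - x / (8 * ln x) \<and>
    K2 \<le> x / (log 2 x - 3 * log 2 (ln x)) \<and>
    x \<le> (log 2 x - 5 / 2 * log 2 (ln x)) * (x / (log 2 x - 3 * log 2 (ln x)) - K2) - x / ln x \<and>
    ln 10 \<le> c * ln x powr (3 / 2)) at_top"
proof -
  have 1: "eventually (\<lambda>x::real. ln x > 1) at_top" by real_asymp
  have 2: "eventually (\<lambda>x::real. log 2 x - 3 * log 2 (ln x) > 0) at_top" by real_asymp
  have 3: "eventually (\<lambda>x::real. log 2 x - 5 / 2 * log 2 (ln x) \<ge> 1) at_top" by real_asymp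
  \<comment> \<open>The quotient \<open>x / (2 * ln x)\<close> stands in for the larger
    \<open>x / D\<close>, because \<open>D \<le> 2 * y\<close>.\<close>
  have "filterlim (\<lambda>x::real. x / (2 * ln x) - x / (8 * ln x)) at_top at_top"
    by real_asymp
  then have 4: "eventually (\<lambda>x. K1 < x / (2 * ln x) - x / (8 * ln x)) at_top"
    by (simp add: filterlim_at_top_dense)
  have "filterlim (\<lambda>x::real. x / (log 2 x - 3 * log 2 (ln x))) at_top at_top"
    by real_asymp
  then have 5: "eventually (\<lambda>x. K2 \<le> x / (log 2 x - 3 * log 2 (ln x))) at_top"
    by (simp add: filterlim_at_top)
  have 6: "eventually (\<lambda>x::real. log 2 (ln x) \<ge> 8) at_top" by real_asymp
  have "filterlim (\<lambda>x::real. x / ln x / (log 2 x - 5 / 2 * log 2 (ln x))) at_top at_top"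
    by real_asymp
  then have 7: "eventually (\<lambda>x. K2 \<le> x / ln x / (log 2 x - 5 / 2 * log 2 (ln x))) at_top"
    by (simp add: filterlim_at_top)
  have "filterlim (\<lambda>x::real. ln x powr (3 / 2)) at_top at_top" by real_asymp
  then have 8: "eventually (\<lambda>x. ln 10 / c \<le> ln x powr (3 / 2)) at_top"
    by (simp add: filterlim_at_top)
  from eventually_gt_at_top[of 0] 1 2 3 4 5 6 7 8 show ?thesis
  proof eventually_elim
    case (elim x)
    define y where "y = ln x"
    define D where "D = log 2 x - 3 * log 2 y"
    define Z where "Z = log 2 x - 5 / 2 * log 2 y"
    note defs = y_def[symmetric] D_def[symmetric] Z_def[symmetric]
    note elim = elim[unfolded defs]
    have Z_eq: "Z = D + log 2 y / 2" by (simp add: Z_def D_def)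
    have "D \<le> 2 * y"
    proof -
      have "y * 1 \<le> y * (2 * ln 2)"
        using elim(2) ln2_ge_two_thirds by (intro mult_left_mono) auto
      then have "log 2 x \<le> 2 * y" by (simp add: log_def y_def divide_le_eq)
      then show ?thesis using elim(7) by (simp add: D_def)
    qed
    then have le: "x / (2 * y) \<le> x / D"
      using elim(1-3) by (intro divide_left_mono) auto
    have K1: "K1 < x / D - x / (8 * y)" using elim(5) le by linarith
    have "K2 * Z \<le> x / y"
    proof -
      have "Z > 0" using elim(4) by linarith
      then show ?thesis using elim(8) by (simp only: pos_le_divide_eq)
    qed
    moreover have "x + 2 * (x / y) \<le> Z * (x / D)"
    proof -
      have "4 * (x / (2 * y)) \<le> log 2 y / 2 * (x / D)"
        using le elim(1-3,7) by (intro mult_mono divide_nonneg_nonneg) linarith+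
      moreover have "Z * (x / D) = x + log 2 y / 2 * (x / D)"
        unfolding Z_eq distrib_right using elim(3) by simp
      ultimately show ?thesis by simp
    qed
    ultimately have "x \<le> Z * (x / D - K2) - x / y"
      by (simp add: right_diff_distrib mult.commute)
    moreover have "ln 10 \<le> c * y powr (3 / 2)"
      using elim(9) assms by (simp add: divide_le_eq mult.commute)
    ultimately show ?case unfolding defs using elim K1 by blast
  qed
qed

section \<open>Asymptotic bound for \<open>S\<close>\<close>

context smooth_power_sums
begin

text \<open>The value of \<open>c\<close> makes \<open>(2 * r + 3) * (2 * c)\<close> equal to 1/8,
  matching the margin \<open>x / (8 * ln x)\<close> in \<open>eventually_parameters\<close>.\<close>

lemma eventually_norm_S_le:
  fixes c :: real
  assumes c: "c = 1 / (16 * (2 * real (card P) + 3))"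
  shows "\<exists>m\<^sub>0. \<forall>m\<in>\<nat>\<^bsub>P\<^esub>. m \<ge> m\<^sub>0 \<longrightarrow> (\<forall>a N. coprime a (int m) \<longrightarrow>
    exp (ln (real m) / (log 2 (ln (real m)) - 3 * log 2 (ln (ln (real m))))) \<le> real N \<longrightarrow>
    cmod (S a m N) \<le> exp (- c * ln (ln (real m)) powr (3 / 2)) * N)"
proof -
  define r where "r = real (card P)"
  define B where "B = real (Max (insert 1 P))"
  have B: "real p \<le> B" if "p \<in> P" for p
    using that finite_P by (simp add: B_def)
  have B1: "B \<ge> 1"
    using finite_P by (simp add: B_def)
  define C where "C = real \<tau> * B"
  have C: "C > 0" using B1 \<tau>_pos by (simp add: C_def)
  have T: "threshold B > 0" using threshold_ge[OF B1] C by (simp add: C_def)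
  have c0: "c > 0" "c \<le> 1 / 48" "(2 * r + 3) * (2 * c) = 1 / 8"
    by (auto simp: c r_def divide_simps)
  have "eventually (\<lambda>m::nat. m > conductor) at_top" by (rule eventually_gt_at_top)
  moreover have "filterlim (\<lambda>m. ln (real m)) at_top at_top" by real_asymp
  note eventually_compose_filterlim[OF eventually_parameters[OF c0(1), of "ln (threshold B)" "ln C"] this]
  ultimately have "eventually (\<lambda>m. \<forall>a N. m \<in> \<nat>\<^bsub>P\<^esub> \<longrightarrow> coprime a (int m) \<longrightarrow>
    exp (ln (real m) / (log 2 (ln (real m)) - 3 * log 2 (ln (ln (real m))))) \<le> real N \<longrightarrow>
    cmod (S a m N) \<le> exp (- c * ln (ln (real m)) powr (3 / 2)) * N) at_top"
  proof eventually_elim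
    case (elim m)
    define x where "x = ln (real m)"
    define y where "y = ln x"
    define Z where "Z = log 2 x - 5 / 2 * log 2 y"
    define W where "W = x / (log 2 x - 3 * log 2 y)"
    define Y where "Y = y powr (3 / 2)"
    have *: "y > 1" "log 2 x - 3 * log 2 y > 0" "Z \<ge> 1" "ln (threshold B) < W - x / (8 * y)"
      "ln C \<le> W" "x \<le> Z * (W - ln C) - x / y" "ln 10 \<le> c * Y"
      using elim(2) unfolding x_def y_def Z_def W_def Y_def by blast+
    have x0: "x > 0" using elim(1) conductor_pos by (simp add: x_def)
    \<comment> \<open>\<open>Suc k\<close> is \<open>Z\<close> rounded up: large enough for
      \<open>(N / C) ^ Suc k\<close> to reach \<open>m\<close> despite the loss in
      \<open>\<theta>\<close>, while \<open>2 ^ k\<close> stays below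
      \<open>2 powr Z\<close>.\<close>
    define k where "k = nat \<lceil>Z\<rceil> - 1"
    have k: "real k < Z" "Z \<le> real (Suc k)"
      unfolding k_def using *(3) by linarith+
    have "(2::real) ^ k \<le> 2 powr Z"
      using k by (simp flip: powr_realpow)
    also have "\<dots> = x / y powr (5 / 2)"
    proof -
      have "2 powr (5 / 2 * log 2 y) = (2 powr log 2 y) powr (5 / 2)"
        by (simp only: powr_powr mult.commute)
      then show ?thesis using x0 *(1) by (simp add: Z_def powr_diff)
    qed
    \<comment> \<open>The exponents 5/2 in \<open>Z\<close> and 3/2 in \<open>Y\<close> differ by 1,
      which leaves exactly the affordable loss \<open>x / y\<close>.\<close>
    finally have "2 ^ k * Y \<le> x / y powr (5 / 2) * Y"
      by (intro mult_right_mono) (auto simp: Y_def)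
    also have "\<dots> = x / y"
    proof -
      have "y powr (5 / 2) = y * Y"
        using *(1) powr_add[of y 1 "3 / 2"] by (simp add: Y_def)
      then show ?thesis using *(1) by (simp add: Y_def)
    qed
    finally have kY: "2 ^ k * Y \<le> x / y" .
    have xy: "x / y \<ge> 0" using x0 *(1) by simp
    \<comment> \<open>The exponent is twice the target, so that half of it absorbs the factor
      10.\<close>
    define \<theta> where "\<theta> = exp (- (2 * c * Y))"
    have Y0: "Y \<ge> 0" by (simp add: Y_def)
    have \<theta>: "0 < \<theta>" "\<theta> \<le> 1" using c0 Y0 by (auto simp: \<theta>_def)
    have \<theta>_pow: "\<theta> ^ n = exp (- (n * (2 * c * Y)))" for n
      by (simp add: \<theta>_def flip: exp_of_nat_mult)
    show ?case
    proof (intro allI impI)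
      fix a and N :: nat
      assume m: "m \<in> \<nat>\<^bsub>P\<^esub>" and a: "coprime a (int m)"
        and "exp (ln (real m) / (log 2 (ln (real m)) - 3 * log 2 (ln (ln (real m))))) \<le> real N"
      then have N: "exp W \<le> real N" by (simp only: x_def y_def W_def)
      then have N0: "real N > 0" using exp_gt_zero[of W] by linarith
      have lnN: "W \<le> ln N" using N N0 by (simp add: ln_ge_iff)
      have large: "threshold B < N * \<theta> ^ (2 ^ k * (2 * card P + 3))"
      proof -
        have "real (2 ^ k * (2 * card P + 3)) * (2 * c * Y) = 2 ^ k * Y * ((2 * r + 3) * (2 * c))"
          by (simp add: r_def)
        also have "\<dots> = 2 ^ k * Y / 8" unfolding c0(3) by simp
        also have "\<dots> \<le> x / (8 * y)" using kY by simp
        finally have "ln (threshold B) < ln N - real (2 ^ k * (2 * card P + 3)) * (2 * c * Y)"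
          using *(4) lnN by linarith
        then have "exp (ln (threshold B)) < exp (ln N + - (real (2 ^ k * (2 * card P + 3)) * (2 * c * Y)))"
          by (simp only: exp_less_cancel_iff)
        then show ?thesis using T N0 unfolding \<theta>_pow exp_add by (simp only: exp_ln)
      qed
      have upper: "m \<le> (N / (\<tau> * B)) ^ Suc k * \<theta> ^ (3 * 2 ^ k - 2)"
      proof -
        have "real (3 * 2 ^ k - 2) \<le> real (3 * 2 ^ k)"
          by (simp only: of_nat_le_iff diff_le_self)
        then have "real (3 * 2 ^ k - 2) * (2 * c * Y) \<le> 3 * 2 ^ k * (2 * c * Y)"
          using c0 Y0 by (intro mult_right_mono) auto
        also have "\<dots> = 6 * c * (2 ^ k * Y)" by simp
        also have "\<dots> \<le> 6 * c * (x / y)" using kY c0 by (intro mult_left_mono) auto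
        also have "\<dots> \<le> 1 * (x / y)" using c0 xy by (intro mult_right_mono) auto
        finally have 1: "real (3 * 2 ^ k - 2) * (2 * c * Y) \<le> x / y" by simp
        have "Z * (W - ln C) \<le> real (Suc k) * (ln N - ln C)"
          using k lnN *(3,5) by (intro mult_mono) auto
        then have "x \<le> real (Suc k) * (ln N - ln C) + - (real (3 * 2 ^ k - 2) * (2 * c * Y))"
          using 1 *(6) by linarith
        then have "exp x \<le> exp (real (Suc k) * (ln N - ln C) + - (real (3 * 2 ^ k - 2) * (2 * c * Y)))"
          by (simp only: exp_le_cancel_iff)
        also have "\<dots> = (N / C) ^ Suc k * \<theta> ^ (3 * 2 ^ k - 2)"
          unfolding exp_add exp_of_nat_mult \<theta>_pow exp_diff using N0 C by (simp only: exp_ln)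
        finally show ?thesis using elim(1) by (simp add: x_def C_def)
      qed
      have "cmod (S a m N) \<le> 10 * \<theta> * N"
        by (rule norm_S_le[OF B B1 \<theta> large m elim(1) upper a order_refl])
      also have "\<dots> \<le> exp (- c * Y) * N"
      proof (intro mult_right_mono)
        have "10 * \<theta> = exp (ln 10 + - (2 * c * Y))" unfolding exp_add \<theta>_def by simp
        also have "\<dots> \<le> exp (- c * Y)"
          unfolding exp_le_cancel_iff using *(7) by linarith
        finally show "10 * \<theta> \<le> exp (- c * Y)" .
      qed auto
      finally show "cmod (S a m N) \<le> exp (- c * ln (ln (real m)) powr (3 / 2)) * N"
        by (simp only: Y_def y_def x_def)
    qed
  qed
  then show ?thesis unfolding eventually_at_top_linorder by blast
qed

end

theorem theorem1p4:
  fixes P :: "nat set"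
  assumes "finite P" and "\<And>p. p \<in> P \<Longrightarrow> prime p"
  shows "\<exists>c::real. c > 0 \<and>
    (\<forall>b::int. b \<ge> 2 \<and> (\<forall>p\<in>P. coprime b (int p)) \<longrightarrow>
      (\<exists>m\<^sub>0::nat. \<forall>m\<in>\<nat>\<^bsub>P\<^esub>. m \<ge> m\<^sub>0 \<longrightarrow>
        (\<forall>(a::int) (N::nat).
          gcd a (int m) = 1 \<and>
          exp (ln (real m) / (log 2 (ln (real m)) - 3 * log 2 (ln (ln (real m))))) \<le> real N \<longrightarrow>
          1 / real N * cmod (\<Sum>n=1..N. e (of_int a / of_nat m * of_int b ^ n))
            \<le> exp (- c * ln (ln (real m)) powr (3 / 2)))))"
\<comment> \<open>The witness depends on \<open>P\<close> only through its cardinality, and not on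
  \<open>b\<close>.\<close>
proof (intro exI[of _ "1 / (16 * (2 * real (card P) + 3))"] conjI allI impI; (elim conjE)?)
  define c where "c = 1 / (16 * (2 * real (card P) + 3))"
  fix b' :: int
  assume b': "b' \<ge> 2" "\<forall>p\<in>P. coprime b' (int p)"
  define b where "b = nat b'"
  have b_eq: "b' = int b" using b' by (simp add: b_def)
  \<comment> \<open>Euler's theorem modulo this product of squares supplies \<open>totient Q\<close>
    as the \<open>\<tau>\<close> of the locale.\<close>
  define Q where "Q = (\<Prod>p\<in>P. p\<^sup>2)"
  have Q0: "Q > 0"
    unfolding Q_def using assms(2) by (intro prod_pos) (simp add: prime_gt_0_nat)
  have "coprime b Q"
    unfolding Q_def using b' by (intro prod_coprime_right) (simp add: b_eq)
  then have euler: "[b ^ totient Q = 1] (mod Q)" by (rule euler_theorem)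
  interpret smooth_power_sums P b "totient Q"
  proof
    show "p\<^sup>2 dvd b ^ totient Q - 1" if "p \<in> P" for p
    proof -
      have "p\<^sup>2 dvd Q"
        unfolding Q_def using that assms(1) by (rule dvd_prodI[rotated])
      also have "Q dvd b ^ totient Q - 1"
        using euler b' by (subst dvd_diff_1_iff_cong) (auto simp: b_def)
      finally show ?thesis .
    qed
  qed (use assms b' Q0 in \<open>auto simp: b_def\<close>)
  obtain m\<^sub>0 where m\<^sub>0: "\<And>m a N. m \<in> \<nat>\<^bsub>P\<^esub> \<Longrightarrow> m \<ge> m\<^sub>0 \<Longrightarrow> coprime a (int m) \<Longrightarrow>
      exp (ln (real m) / (log 2 (ln (real m)) - 3 * log 2 (ln (ln (real m))))) \<le> real N \<Longrightarrow>
      cmod (S a m N) \<le> exp (- c * ln (ln (real m)) powr (3 / 2)) * N"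
    using eventually_norm_S_le[OF c_def] by blast
  show "\<exists>m\<^sub>0::nat. \<forall>m\<in>\<nat>\<^bsub>P\<^esub>. m \<ge> m\<^sub>0 \<longrightarrow>
        (\<forall>(a::int) (N::nat).
          gcd a (int m) = 1 \<and>
          exp (ln (real m) / (log 2 (ln (real m)) - 3 * log 2 (ln (ln (real m))))) \<le> real N \<longrightarrow>
          1 / real N * cmod (\<Sum>n=1..N. e (of_int a / of_nat m * of_int b' ^ n))
            \<le> exp (- (1 / (16 * (2 * real (card P) + 3))) * ln (ln (real m)) powr (3 / 2)))"
  proof (intro exI[of _ m\<^sub>0] ballI allI impI; elim conjE)
    fix m a N
    assume m: "m \<in> \<nat>\<^bsub>P\<^esub>" "m \<ge> m\<^sub>0" and a: "gcd a (int m) = 1"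
      and N: "exp (ln (real m) / (log 2 (ln (real m)) - 3 * log 2 (ln (ln (real m))))) \<le> real N"
    have N0: "real N > 0" by (rule less_le_trans[OF exp_gt_zero N])
    have "(\<Sum>n=1..N. e (of_int a / of_nat m * of_int b' ^ n)) = S a m N"
      by (simp add: S_def unit_char_def b_eq)
    moreover have "cmod (S a m N) \<le> exp (- c * ln (ln (real m)) powr (3 / 2)) * N"
      using m a N by (intro m\<^sub>0) (auto simp: coprime_iff_gcd_eq_1)
    ultimately show "1 / real N * cmod (\<Sum>n=1..N. e (of_int a / of_nat m * of_int b' ^ n))
        \<le> exp (- (1 / (16 * (2 * real (card P) + 3))) * ln (ln (real m)) powr (3 / 2))"
      using N0 by (simp add: c_def divide_le_eq)
  qed
qed simp

end
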